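(* Let $\nabla_0$ and $\nabla_0^{\dagger}$ be the operators on $\mathcal{F}_0$ defined in the context. Then $$\nabla_0^{\dagger}\nabla_0=\frac{\partial^2}{\partial x_1^2}+\frac{\partial^2}{\partial x_2^2}.$$
   Context: $\mathbb{H}_0$ (the $0$-scaled hypercomplexes) is the associative unital real algebra with $\mathbb{R}$-basis $\{1,i,j_0,k_0\}$ and multiplication determined by $i^2=-1$, $j_0^2=k_0^2=0$, $ij_0=k_0$, $j_0k_0=0$, $k_0i=j_0$, $j_0i=-k_0$, $ik_0=-j_0$, $k_0j_0=0$. Its elements are written $w=x_1+x_2i+x_3j_0+x_4k_0$ with $x_1,x_2,x_3,x_4\in\mathbb{R}$. $\mathcal{T}_0$ is the topology on $\mathbb{H}_0$ induced by the semi-norm $\|w\|_0=\sqrt{x_1^2+x_2^2}$. For a connected $U\in\mathcal{T}_0$, $\mathcal{F}_{0,U}$ is the set of functions $f:\mathbb{H}_0\to\mathbb{H}_0$ that are $\mathbb{R}$-differentiable on $U$ ($U$ being regarded as an open subset of $\mathbb{R}^4$), and $\mathcal{F}_0=\bigcup_U\mathcal{F}_{0,U}$. The operators are $$\nabla_0=\frac{\partial}{\partial x_1}+i\frac{\partial}{\partial x_2}+j_0\frac{\partial}{\partial x_3}+k_0\frac{\partial}{\partial x_4},\qquad \nabla_0^{\dagger}=\frac{\partial}{\partial x_1}-\frac{\partial}{\partial x_2}i-\frac{\partial}{\partial x_3}j_0-\frac{\partial}{\partial x_4}k_0,$$ where in $\nabla_0^{\dagger}\nabla_0$ the constant units multiply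 from the left.
   Formalization: The formal theorem also assumes that the four first partial derivatives of f are ℝ-differentiable on U; for f merely ℝ-differentiable, the composite may be undefined or the identity may fail because mixed second partials need not commute. *)

theory Defs
  imports "HOL-Analysis.Analysis"
begin

text \<open>The 0-scaled hypercomplexes: \<open>HC x1 x2 x3 x4\<close> is \<open>x1 + x2 i + x3 j + x4 k\<close>.\<close>

datatype hyp0 = HC (cx1: real) (cx2: real) (cx3: real) (cx4: real)

lemma hyp0_eq_iff: "w = z \<longleftrightarrow> cx1 w = cx1 z \<and> cx2 w = cx2 z \<and> cx3 w = cx3 z \<and> cx4 w = cx4 z"
  by (cases w; cases z) simp

text \<open>The product is the bilinear extension of the multiplication table, which is
  recovered below as \<open>hyp0_mult_table\<close>.\<close>

instantiation hyp0 :: real_algebra_1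
begin

definition "0 = HC 0 0 0 0"
definition "1 = HC 1 0 0 0"
definition "w + z = HC (cx1 w + cx1 z) (cx2 w + cx2 z) (cx3 w + cx3 z) (cx4 w + cx4 z)"
definition "- w = HC (- cx1 w) (- cx2 w) (- cx3 w) (- cx4 w)"
definition "w - z = HC (cx1 w - cx1 z) (cx2 w - cx2 z) (cx3 w - cx3 z) (cx4 w - cx4 z)"
definition "scaleR r w = HC (r * cx1 w) (r * cx2 w) (r * cx3 w) (r * cx4 w)"
definition "w * z = HC
   (cx1 w * cx1 z - cx2 w * cx2 z)
   (cx1 w * cx2 z + cx2 w * cx1 z)
   (cx1 w * cx3 z + cx3 w * cx1 z - cx2 w * cx4 z + cx4 w * cx2 z)
   (cx1 w * cx4 z + cx4 w * cx1 z + cx2 w * cx3 z - cx3 w * cx2 z)"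

instance
  by standard
    (simp_all add: hyp0_eq_iff zero_hyp0_def one_hyp0_def plus_hyp0_def uminus_hyp0_def
      minus_hyp0_def scaleR_hyp0_def times_hyp0_def algebra_simps)

end

definition hi :: hyp0 where "hi = HC 0 1 0 0"
definition hj :: hyp0 where "hj = HC 0 0 1 0"
definition hk :: hyp0 where "hk = HC 0 0 0 1"

lemma hyp0_sel [simp]:
  "cx1 0 = 0" "cx2 0 = 0" "cx3 0 = 0" "cx4 0 = 0"
  "cx1 1 = 1" "cx2 1 = 0" "cx3 1 = 0" "cx4 1 = 0"
  "cx1 hi = 0" "cx2 hi = 1" "cx3 hi = 0" "cx4 hi = 0"
  "cx1 hj = 0" "cx2 hj = 0" "cx3 hj = 1" "cx4 hj = 0"
  "cx1 hk = 0" "cx2 hk = 0" "cx3 hk = 0" "cx4 hk = 1"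
  "cx1 (w + z) = cx1 w + cx1 z" "cx2 (w + z) = cx2 w + cx2 z"
  "cx3 (w + z) = cx3 w + cx3 z" "cx4 (w + z) = cx4 w + cx4 z"
  "cx1 (- w) = - cx1 w" "cx2 (- w) = - cx2 w" "cx3 (- w) = - cx3 w" "cx4 (- w) = - cx4 w"
  "cx1 (w - z) = cx1 w - cx1 z" "cx2 (w - z) = cx2 w - cx2 z"
  "cx3 (w - z) = cx3 w - cx3 z" "cx4 (w - z) = cx4 w - cx4 z"
  "cx1 (r *\<^sub>R w) = r * cx1 w" "cx2 (r *\<^sub>R w) = r * cx2 w"
  "cx3 (r *\<^sub>R w) = r * cx3 w" "cx4 (r *\<^sub>R w) = r * cx4 w"
  by (simp_all add: zero_hyp0_def one_hyp0_def hi_def hj_def hk_def plus_hyp0_def uminus_hyp0_def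
      minus_hyp0_def scaleR_hyp0_def)

lemma HC_eq: "HC a b c d = a *\<^sub>R 1 + b *\<^sub>R hi + c *\<^sub>R hj + d *\<^sub>R hk"
  by (simp add: hyp0_eq_iff)

lemma hyp0_mult_table:
  "hi * hi = -1" "hi * hj = hk" "hi * hk = - hj"
  "hj * hi = - hk" "hj * hj = 0" "hj * hk = 0"
  "hk * hi = hj" "hk * hj = 0" "hk * hk = 0"
  by (simp_all add: hyp0_eq_iff times_hyp0_def)

text \<open>The type class topology and norm below are the Euclidean ones of \<open>\<real>\<^sup>4\<close>, so that
  the library's \<open>differentiable\<close> means real differentiability in four real variables.
  The coarser topology given by the semi-norm is the separate object \<open>topology0\<close>.\<close>

instantiation hyp0 :: real_inner
begin

definition "inner w z = cx1 w * cx1 z + cx2 w * cx2 z + cx3 w * cx3 z + cx4 w * cx4 z"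
definition "norm (w::hyp0) = sqrt (inner w w)"
definition "sgn (w::hyp0) = inverse (norm w) *\<^sub>R w"
definition "dist (w::hyp0) z = norm (w - z)"
definition [code del]:
  "(uniformity :: (hyp0 \<times> hyp0) filter) = (INF e\<in>{0 <..}. principal {(w, z). dist w z < e})"
definition [code del]:
  "open (U :: hyp0 set) \<longleftrightarrow> (\<forall>w\<in>U. eventually (\<lambda>(w', z). w' = w \<longrightarrow> z \<in> U) uniformity)"

instance
proof
  fix w z u :: hyp0 and r :: real
  show "0 \<le> inner w w"
    by (simp add: inner_hyp0_def)
  show "inner w w = 0 \<longleftrightarrow> w = 0"
  proof
    assume "inner w w = 0"
    hence "(cx1 w)\<^sup>2 + (cx2 w)\<^sup>2 + (cx3 w)\<^sup>2 + (cx4 w)\<^sup>2 = 0"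
      by (simp add: inner_hyp0_def power2_eq_square)
    thus "w = 0" by (simp add: hyp0_eq_iff add_nonneg_eq_0_iff)
  qed (simp add: inner_hyp0_def)
qed (simp_all add: inner_hyp0_def norm_hyp0_def sgn_hyp0_def dist_hyp0_def uniformity_hyp0_def
      open_hyp0_def algebra_simps)

end

instantiation hyp0 :: euclidean_space
begin

definition "Basis = {1, hi, hj, hk}"

instance
proof
  fix u v w :: hyp0
  show "u \<in> Basis \<Longrightarrow> v \<in> Basis \<Longrightarrow> inner u v = (if u = v then 1 else 0)"
    by (auto simp: Basis_hyp0_def inner_hyp0_def hyp0_eq_iff)
  show "(\<forall>u\<in>Basis. inner w u = 0) \<longleftrightarrow> w = 0"
    unfolding Basis_hyp0_def by (simp add: inner_hyp0_def) (simp add: hyp0_eq_iff)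
qed (auto simp: Basis_hyp0_def)

end

definition seminorm0 :: "hyp0 \<Rightarrow> real"
  where "seminorm0 w = sqrt ((cx1 w)\<^sup>2 + (cx2 w)\<^sup>2)"

definition topology0 :: "hyp0 topology"
  where "topology0 = topology (\<lambda>U. \<forall>w\<in>U. \<exists>e>0. \<forall>z. seminorm0 (z - w) < e \<longrightarrow> z \<in> U)"

lemma openin_topology0:
  "openin topology0 U \<longleftrightarrow> (\<forall>w\<in>U. \<exists>e>0. \<forall>z. seminorm0 (z - w) < e \<longrightarrow> z \<in> U)"
proof -
  have "istopology (\<lambda>U. \<forall>w\<in>U. \<exists>e>0. \<forall>z. seminorm0 (z - w) < e \<longrightarrow> z \<in> U)"
    unfolding istopology_def
  proof (intro conjI allI impI ballI)
    fix S T w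
    assume S: "\<forall>w\<in>S. \<exists>e>0. \<forall>z. seminorm0 (z - w) < e \<longrightarrow> z \<in> S"
      and T: "\<forall>w\<in>T. \<exists>e>0. \<forall>z. seminorm0 (z - w) < e \<longrightarrow> z \<in> T" and w: "w \<in> S \<inter> T"
    from S w obtain d where "d > 0" "\<forall>z. seminorm0 (z - w) < d \<longrightarrow> z \<in> S" by blast
    moreover from T w obtain e where "e > 0" "\<forall>z. seminorm0 (z - w) < e \<longrightarrow> z \<in> T" by blast
    ultimately show "\<exists>e>0. \<forall>z. seminorm0 (z - w) < e \<longrightarrow> z \<in> S \<inter> T"
      by (intro exI[of _ "min d e"]) auto
  next
    fix \<K> w
    assume "\<forall>K\<in>\<K>. \<forall>w\<in>K. \<exists>e>0. \<forall>z. seminorm0 (z - w) < e \<longrightarrow> z \<in> K" "w \<in> \<Union>\<K>"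
    thus "\<exists>e>0. \<forall>z. seminorm0 (z - w) < e \<longrightarrow> z \<in> \<Union>\<K>" by (meson UnionE UnionI)
  qed
  thus ?thesis by (simp add: topology0_def topology_inverse')
qed

definition differentiable_functions0 :: "hyp0 set \<Rightarrow> (hyp0 \<Rightarrow> hyp0) set"
  where "differentiable_functions0 U = {f. f differentiable_on U}"

text \<open>\<open>partial e f\<close> for \<open>e = 1, hi, hj, hk\<close> is the partial derivative of \<open>f\<close> with respect to
  the first, second, third, fourth real coordinate.\<close>

definition partial :: "hyp0 \<Rightarrow> (hyp0 \<Rightarrow> hyp0) \<Rightarrow> hyp0 \<Rightarrow> hyp0"
  where "partial e f w = vector_derivative (\<lambda>t. f (w + t *\<^sub>R e)) (at 0)"

definition nabla0 :: "(hyp0 \<Rightarrow> hyp0) \<Rightarrow> hyp0 \<Rightarrow> hyp0"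
  where "nabla0 f w =
    partial 1 f w + hi * partial hi f w + hj * partial hj f w + hk * partial hk f w"

definition nabla0_dagger :: "(hyp0 \<Rightarrow> hyp0) \<Rightarrow> hyp0 \<Rightarrow> hyp0"
  where "nabla0_dagger f w =
    partial 1 f w - hi * partial hi f w - hj * partial hj f w - hk * partial hk f w"

end

theory Submission
  imports Defs
begin

text \<open>In \<open>\<nabla>\<^sub>0\<^sup>\<dagger> \<nabla>\<^sub>0 f\<close> the terms \<open>\<partial>\<^sub>1\<^sub>1 f\<close> and \<open>- i\<^sup>2 \<partial>\<^sub>2\<^sub>2 f = \<partial>\<^sub>2\<^sub>2 f\<close> survive, the remaining squares vanish
  and all other terms cancel in pairs because mixed second partials commute. Only
  differentiability of the first partials is assumed, not continuity of the second ones, so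
  this symmetry is Young's theorem: the second difference of \<open>f\<close> along \<open>u\<close> and \<open>v\<close>, divided
  by \<open>t\<^sup>2\<close>, tends to both mixed derivatives.\<close>

text \<open>Mean value inequality on \<open>{0..t}\<close> for the increment of \<open>f\<close>
  along \<open>t *\<^sub>R v\<close>, corrected by a term linear in \<open>s\<close>. Only
  first-order accuracy of \<open>fu\<close> at \<open>w\<close> enters, which is why no continuity
  of second derivatives is required.\<close>

lemma second_difference_bound:
  fixes f :: "'a::real_normed_vector \<Rightarrow> 'b::real_normed_vector"
  assumes "open S" "w \<in> S"
    and fu: "\<And>x. x \<in> S \<Longrightarrow> ((\<lambda>t. f (x + t *\<^sub>R u)) has_vector_derivative fu x) (at 0)"
    and D: "(fu has_derivative D) (at w)"
    and "e > 0"
  obtains d where "d > 0"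
    "\<And>t. 0 < t \<Longrightarrow> t < d \<Longrightarrow>
      norm (f (w + t *\<^sub>R u + t *\<^sub>R v) - f (w + t *\<^sub>R u) - f (w + t *\<^sub>R v) + f w - t\<^sup>2 *\<^sub>R D v)
        \<le> e * t\<^sup>2 * (2 * norm u + norm v)"
proof -
  from D \<open>e > 0\<close> obtain d1 where "d1 > 0"
    and d1: "\<And>y. norm (y - w) < d1 \<Longrightarrow> norm (fu y - fu w - D (y - w)) \<le> e * norm (y - w)"
    by (auto simp: has_derivative_at_alt)
  from \<open>open S\<close> \<open>w \<in> S\<close> obtain d2 where "d2 > 0" and d2: "\<And>y. norm (y - w) < d2 \<Longrightarrow> y \<in> S"
    by (auto simp: open_dist dist_norm)
  \<comment> \<open>\<open>t * N\<close> dominates every offset from \<open>w\<close> used below;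
    the summand 1 makes this strict and keeps \<open>N\<close> positive when
    \<open>u = v = 0\<close>.\<close>
  define N where "N = norm u + norm v + 1"
  have "N > 0" by (simp add: N_def add_nonneg_pos)
  define d where "d = min d1 d2 / N"
  have "d > 0" using \<open>d1 > 0\<close> \<open>d2 > 0\<close> \<open>N > 0\<close> by (simp add: d_def)
  interpret D: bounded_linear D using D by (rule has_derivative_bounded_linear)
  show thesis
  proof (rule that[OF \<open>d > 0\<close>])
    fix t :: real assume t: "0 < t" "t < d"
    have tN: "t * N < min d1 d2" using t \<open>N > 0\<close> by (simp add: d_def pos_less_divide_eq)
    have small: "norm (s *\<^sub>R u + r *\<^sub>R v) \<le> s * norm u + r * norm v"
      "norm (s *\<^sub>R u + r *\<^sub>R v) < min d1 d2" if "s \<in> {0..t}" "r \<in> {0, t}" for s r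
    proof -
      have "norm (s *\<^sub>R u + r *\<^sub>R v) \<le> norm (s *\<^sub>R u) + norm (r *\<^sub>R v)" by (rule norm_triangle_ineq)
      also have "\<dots> = s * norm u + r * norm v" using that t by auto
      finally show 1: "norm (s *\<^sub>R u + r *\<^sub>R v) \<le> s * norm u + r * norm v" .
      also have "\<dots> \<le> t * norm u + t * norm v"
        using that t by (intro add_mono mult_right_mono) auto
      also have "\<dots> < t * N" using t by (simp add: N_def algebra_simps)
      finally show "norm (s *\<^sub>R u + r *\<^sub>R v) < min d1 d2" using tN by simp
    qed
    \<comment> \<open>The hypothesis on \<open>fu\<close> differentiates at parameter 0 only;
      translating the base point moves this to \<open>s\<close>. The cases \<open>r = t\<close> and
      \<open>r = 0\<close> serve the two values of \<open>f\<close> in \<open>g\<close>.\<close>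
    have deriv: "((\<lambda>s. f (w + s *\<^sub>R u + r *\<^sub>R v)) has_vector_derivative fu (w + s *\<^sub>R u + r *\<^sub>R v)) (at s within {0..t})"
      if "s \<in> {0..t}" "r \<in> {0, t}" for s r
    proof -
      have "w + s *\<^sub>R u + r *\<^sub>R v \<in> S"
        using small(2)[OF that] by (intro d2) (simp add: add.assoc)
      from fu[OF this]
      have "((\<lambda>h. f (w + s *\<^sub>R u + r *\<^sub>R v + h *\<^sub>R u)) has_vector_derivative fu (w + s *\<^sub>R u + r *\<^sub>R v)) (at (s - s))"
        by simp
      moreover have "((\<lambda>x. x - s) has_vector_derivative 1) (at s)"
        by (auto intro!: derivative_eq_intros)
      ultimately
      have "((\<lambda>x. f (w + s *\<^sub>R u + r *\<^sub>R v + (x - s) *\<^sub>R u)) has_vector_derivative fu (w + s *\<^sub>R u + r *\<^sub>R v)) (at s)"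
        by (auto dest: vector_diff_chain_at simp: o_def)
      moreover have "w + s *\<^sub>R u + r *\<^sub>R v + (x - s) *\<^sub>R u = w + x *\<^sub>R u + r *\<^sub>R v" for x
        by (simp add: algebra_simps)
      ultimately show ?thesis by (simp add: has_vector_derivative_at_within)
    qed
    \<comment> \<open>The correction \<open>(s * t) *\<^sub>R D v\<close> turns the increment of
      \<open>g\<close> from 0 to \<open>t\<close> into the second difference minus
      \<open>t\<^sup>2 *\<^sub>R D v\<close>.\<close>
    define g where "g s = f (w + s *\<^sub>R u + t *\<^sub>R v) - f (w + s *\<^sub>R u) - (s * t) *\<^sub>R D v" for s
    define g' where "g' s = fu (w + s *\<^sub>R u + t *\<^sub>R v) - fu (w + s *\<^sub>R u) - t *\<^sub>R D v" for s
    have g: "(g has_derivative (\<lambda>h. h *\<^sub>R g' s)) (at s within {0..t})" if "s \<in> {0..t}" for s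
      using deriv[OF that, of t] deriv[OF that, of 0]
      unfolding g_def g'_def has_vector_derivative_def
      by (auto intro!: derivative_eq_intros simp: algebra_simps)
    have g': "norm (g' s) \<le> e * t * (2 * norm u + norm v)" if s: "s \<in> {0..t}" for s
    proof -
      have R: "norm (fu (w + s *\<^sub>R u + r *\<^sub>R v) - fu w - D (s *\<^sub>R u + r *\<^sub>R v)) \<le> e * (s * norm u + r * norm v)"
        if "r \<in> {0, t}" for r
      proof -
        have "norm (fu (w + s *\<^sub>R u + r *\<^sub>R v) - fu w - D (s *\<^sub>R u + r *\<^sub>R v)) \<le> e * norm (s *\<^sub>R u + r *\<^sub>R v)"
          using d1[of "w + s *\<^sub>R u + r *\<^sub>R v"] small(2)[OF s that] by (simp add: add.assoc)
        also have "\<dots> \<le> e * (s * norm u + r * norm v)"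
          using small(1)[OF s that] \<open>e > 0\<close> by (intro mult_left_mono) auto
        finally show ?thesis .
      qed
      \<comment> \<open>By linearity of \<open>D\<close>, \<open>g' s\<close> is a difference of two
        remainders of \<open>fu\<close> at \<open>w\<close>. Both contribute
        \<open>s * norm u\<close>, hence the factor 2; the zero multiples of \<open>v\<close> match
        \<open>R\<close> at \<open>r = 0\<close>.\<close>
      have "g' s = (fu (w + s *\<^sub>R u + t *\<^sub>R v) - fu w - D (s *\<^sub>R u + t *\<^sub>R v))
          - (fu (w + s *\<^sub>R u + 0 *\<^sub>R v) - fu w - D (s *\<^sub>R u + 0 *\<^sub>R v))"
        by (simp add: g'_def D.add D.scaleR)
      also have "norm \<dots> \<le> e * (s * norm u + t * norm v) + e * (s * norm u + 0 * norm v)"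
        by (intro order_trans[OF norm_triangle_ineq4] add_mono R) auto
      also have "\<dots> = e * (2 * (s * norm u) + t * norm v)" by (simp add: algebra_simps)
      also have "\<dots> \<le> e * (2 * (t * norm u) + t * norm v)"
        using s \<open>e > 0\<close> by (intro mult_left_mono add_mono mult_right_mono) auto
      finally show ?thesis by (simp add: algebra_simps)
    qed
    have "norm (g t - g 0) \<le> e * t * (2 * norm u + norm v) * norm (t - 0)"
    proof (rule differentiable_bound[OF _ g])
      fix s assume s: "s \<in> {0..t}"
      show "onorm (\<lambda>h. h *\<^sub>R g' s) \<le> e * t * (2 * norm u + norm v)"
        using mult_left_mono[OF g'[OF s]] by (intro onorm_le) (simp add: mult.commute)
    qed (use t in auto)
    moreover have "g t - g 0 =
        f (w + t *\<^sub>R u + t *\<^sub>R v) - f (w + t *\<^sub>R u) - f (w + t *\<^sub>R v) + f w - t\<^sup>2 *\<^sub>R D v"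
      by (simp add: g_def power2_eq_square)
    moreover have "e * t * (2 * norm u + norm v) * norm (t - 0) = e * t\<^sup>2 * (2 * norm u + norm v)"
      using t by (simp add: power2_eq_square)
    ultimately show "norm (f (w + t *\<^sub>R u + t *\<^sub>R v) - f (w + t *\<^sub>R u) - f (w + t *\<^sub>R v) + f w - t\<^sup>2 *\<^sub>R D v)
        \<le> e * t\<^sup>2 * (2 * norm u + norm v)" by metis
  qed
qed

text \<open>The second difference is symmetric in \<open>u\<close> and \<open>v\<close>, so the
  preceding bound, used in both orders, places the same quantity near
  \<open>t\<^sup>2 *\<^sub>R D v\<close> and near \<open>t\<^sup>2 *\<^sub>R E u\<close>.\<close>

theorem Young_symmetric_derivative:
  fixes f :: "'a::real_normed_vector \<Rightarrow> 'b::real_normed_vector"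
  assumes "open S" "w \<in> S"
    and fu: "\<And>x. x \<in> S \<Longrightarrow> ((\<lambda>t. f (x + t *\<^sub>R u)) has_vector_derivative fu x) (at 0)"
    and fv: "\<And>x. x \<in> S \<Longrightarrow> ((\<lambda>t. f (x + t *\<^sub>R v)) has_vector_derivative fv x) (at 0)"
    and D: "(fu has_derivative D) (at w)" and E: "(fv has_derivative E) (at w)"
  shows "D v = E u"
proof -
  \<comment> \<open>The constants of the two bounds add up to \<open>3 * (norm u + norm v)\<close>;
    adding 1 allows division by \<open>N\<close>.\<close>
  define N where "N = 3 * (norm u + norm v) + 1"
  have "N > 0" by (simp add: N_def add_nonneg_pos)
  have "norm (D v - E u) \<le> 0 + e" if "e > 0" for e
  proof -
    define e' where "e' = e / N"
    have e': "e' > 0" "e' * N = e" using that \<open>N > 0\<close> by (simp_all add: e'_def)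
    obtain d1 where "d1 > 0" and d1: "\<And>t. 0 < t \<Longrightarrow> t < d1 \<Longrightarrow>
      norm (f (w + t *\<^sub>R u + t *\<^sub>R v) - f (w + t *\<^sub>R u) - f (w + t *\<^sub>R v) + f w - t\<^sup>2 *\<^sub>R D v)
        \<le> e' * t\<^sup>2 * (2 * norm u + norm v)"
      using second_difference_bound[OF \<open>open S\<close> \<open>w \<in> S\<close> fu D e'(1)] by blast
    obtain d2 where "d2 > 0" and d2: "\<And>t. 0 < t \<Longrightarrow> t < d2 \<Longrightarrow>
      norm (f (w + t *\<^sub>R v + t *\<^sub>R u) - f (w + t *\<^sub>R v) - f (w + t *\<^sub>R u) + f w - t\<^sup>2 *\<^sub>R E u)
        \<le> e' * t\<^sup>2 * (2 * norm v + norm u)"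
      using second_difference_bound[OF \<open>open S\<close> \<open>w \<in> S\<close> fv E e'(1)] by blast
    define t where "t = min d1 d2 / 2"
    have t: "0 < t" "t < d1" "t < d2" using \<open>d1 > 0\<close> \<open>d2 > 0\<close> by (auto simp: t_def)
    have "t\<^sup>2 * norm (D v - E u) = norm (t\<^sup>2 *\<^sub>R (D v - E u))" by simp
    also have "t\<^sup>2 *\<^sub>R (D v - E u) =
        (f (w + t *\<^sub>R v + t *\<^sub>R u) - f (w + t *\<^sub>R v) - f (w + t *\<^sub>R u) + f w - t\<^sup>2 *\<^sub>R E u)
        - (f (w + t *\<^sub>R u + t *\<^sub>R v) - f (w + t *\<^sub>R u) - f (w + t *\<^sub>R v) + f w - t\<^sup>2 *\<^sub>R D v)"
      by (simp add: algebra_simps)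
    also have "norm \<dots> \<le> e' * t\<^sup>2 * (2 * norm v + norm u) + e' * t\<^sup>2 * (2 * norm u + norm v)"
      by (intro order_trans[OF norm_triangle_ineq4] add_mono d1 d2 t)
    also have "\<dots> \<le> e' * t\<^sup>2 * N"
      using e'(1) by (simp add: N_def algebra_simps)
    also have "\<dots> = t\<^sup>2 * e" using e'(2) by (simp add: algebra_simps)
    finally show ?thesis using t by simp
  qed
  then have "norm (D v - E u) \<le> 0" by (rule field_le_epsilon)
  then show ?thesis by simp
qed

lemma seminorm0_le_norm: "seminorm0 w \<le> norm w"
  by (simp add: seminorm0_def norm_hyp0_def inner_hyp0_def power2_eq_square)

text \<open>Euclidean balls lie inside semi-norm balls of the same radius. Openness turns
  differentiability on \<open>U\<close> into differentiability at each point, with unrestricted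
  neighbourhoods.\<close>

lemma open_if_openin_topology0:
  assumes "openin topology0 U"
  shows "open U"
  unfolding open_dist dist_norm
  using assms seminorm0_le_norm by (meson openin_topology0 le_less_trans)

lemma has_vector_derivative_partial:
  assumes "(f has_derivative D) (at x)"
  shows "((\<lambda>t. f (x + t *\<^sub>R u)) has_vector_derivative D u) (at 0)"
proof -
  interpret bounded_linear D using assms by (rule has_derivative_bounded_linear)
  have "((\<lambda>t. x + t *\<^sub>R u) has_derivative (\<lambda>t. t *\<^sub>R u)) (at 0)"
    by (auto intro!: derivative_eq_intros)
  from has_derivative_compose[OF this, of f D] assms show ?thesis
    by (simp add: has_vector_derivative_def scaleR)
qed

lemma partial_eq:
  assumes "(f has_derivative D) (at x)"
  shows "partial e f x = D e"
  unfolding partial_def using has_vector_derivative_partial[OF assms]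
  by (rule vector_derivative_at)

text \<open>Differentiability of \<open>f\<close> supplies the directional derivatives throughout
  \<open>U\<close>; that of the two first partials supplies \<open>D\<close> and \<open>E\<close> at
  \<open>w\<close>, whose values \<open>D v\<close> and \<open>E u\<close> are the mixed
  partials.\<close>

lemma partial_commute:
  assumes "open U" "w \<in> U" "f differentiable_on U"
    "partial u f differentiable_on U" "partial v f differentiable_on U"
  shows "partial v (partial u f) w = partial u (partial v f) w"
proof -
  have at: "\<exists>D. (g has_derivative D) (at x)" if "g differentiable_on U" "x \<in> U" for g x
    using that \<open>open U\<close> by (metis differentiable_on_eq_differentiable_at differentiable_def)
  have f: "((\<lambda>t. f (x + t *\<^sub>R e)) has_vector_derivative partial e f x) (at 0)"
    if "x \<in> U" for x e
    using at[OF assms(3) that] has_vector_derivative_partial partial_eq by metis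
  obtain D E where "(partial u f has_derivative D) (at w)" "(partial v f has_derivative E) (at w)"
    using at assms by metis
  with Young_symmetric_derivative[OF assms(1,2) f f] show ?thesis
    by (simp add: partial_eq)
qed

text \<open>Boundedness comes from finite dimension: the Euclidean norm is not submultiplicative, as
  the square of \<open>1 + hj\<close> shows.\<close>

lemma bounded_linear_mult_left_hyp0: "bounded_linear (\<lambda>z::hyp0. c * z)"
  by (intro linear_conv_bounded_linear[THEN iffD1] linearI) (simp_all add: algebra_simps)

text \<open>Left multiplication by a constant unit is bounded linear, so it passes through the
  derivative.\<close>

lemma partial_nabla0:
  assumes "\<And>e. e \<in> {1, hi, hj, hk} \<Longrightarrow> partial e f differentiable at w"
  shows "partial u (nabla0 f) w = partial u (partial 1 f) w + hi * partial u (partial hi f) w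
    + hj * partial u (partial hj f) w + hk * partial u (partial hk f) w"
proof -
  obtain A B C D where d: "(partial 1 f has_derivative A) (at w)"
    "(partial hi f has_derivative B) (at w)" "(partial hj f has_derivative C) (at w)"
    "(partial hk f has_derivative D) (at w)"
    using assms by (metis differentiable_def insertCI)
  note m = bounded_linear.has_derivative[OF bounded_linear_mult_left_hyp0]
  have "(nabla0 f has_derivative (\<lambda>h. A h + hi * B h + hj * C h + hk * D h)) (at w)"
    unfolding nabla0_def[abs_def] by (intro has_derivative_add m d)
  then show ?thesis using d by (simp add: partial_eq)
qed

theorem theorem48:
  fixes U :: "hyp0 set" and f :: "hyp0 \<Rightarrow> hyp0"
  assumes "openin topology0 U" and "connectedin topology0 U"
    and "f \<in> differentiable_functions0 U"
    and "\<And>e. e \<in> {1, hi, hj, hk} \<Longrightarrow> partial e f \<in> differentiable_functions0 U"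
    and "w \<in> U"
  shows "nabla0_dagger (nabla0 f) w = partial 1 (partial 1 f) w + partial hi (partial hi f) w"
proof -
  have U: "open U" using assms(1) by (rule open_if_openin_topology0)
  have diff: "f differentiable_on U"
    "\<And>e. e \<in> {1, hi, hj, hk} \<Longrightarrow> partial e f differentiable_on U"
    using assms(3,4) by (auto simp: differentiable_functions0_def)
  then have "partial u (nabla0 f) w = partial u (partial 1 f) w + hi * partial u (partial hi f) w
      + hj * partial u (partial hj f) w + hk * partial u (partial hk f) w" for u
    using U \<open>w \<in> U\<close> by (intro partial_nabla0) (metis differentiable_on_eq_differentiable_at)
  \<comment> \<open>Each equation is oriented so that the outer direction becomes the earlier one in
    the order \<open>1\<close>, \<open>hi\<close>, \<open>hj\<close>, \<open>hk\<close>.\<close>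
  moreover have "partial hi (partial 1 f) w = partial 1 (partial hi f) w"
    "partial hj (partial 1 f) w = partial 1 (partial hj f) w"
    "partial hk (partial 1 f) w = partial 1 (partial hk f) w"
    "partial hj (partial hi f) w = partial hi (partial hj f) w"
    "partial hk (partial hi f) w = partial hi (partial hk f) w"
    "partial hk (partial hj f) w = partial hj (partial hk f) w"
    by (intro partial_commute[OF U \<open>w \<in> U\<close>] diff; simp)+
  \<comment> \<open>What remains is linear in the second partials and is checked by coordinates:
    \<open>hi\<close> anticommutes with \<open>hj\<close> and \<open>hk\<close>, while all products
    among \<open>hj\<close> and \<open>hk\<close> vanish.\<close>
  ultimately show ?thesis
    unfolding nabla0_dagger_def by (simp add: hyp0_eq_iff times_hyp0_def)
qed

end
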